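(* Let $0<\alpha<\beta$ be real numbers and let $N\ge2$ be an integer. There exists $\lambda_2>0$ satisfying $$G_2(\lambda)\ \ge\ \max\left\{\left(\frac{\theta_\beta}{\theta_\alpha}\right)^{\frac1{\beta-\alpha}},\left(\frac{\beta}{\alpha}\right)^{\frac1{\beta-\alpha}}\right\}\qquad\text{for all }\lambda\ge2\text{ with }\lambda\ge\lambda_2,$$ such that for every $\lambda\ge\max\{2,\lambda_2\}$ the following holds. Put $r_0=\dfrac{G_2(\lambda)}{\sqrt{\lambda^2-1}}$, and let $q=(Q_1,Q_2,Q_3,q_1,\dots,q_N)\in(\mathbb{R}^3)^{3+N}$ be given by $$Q_1=(0,0,r_0),\quad Q_2=(0,0,-r_0),\quad Q_3=(0,0,0),\quad q_k=\sqrt{\lambda^2-1}\;r_0\left(\cos\tfrac{2\pi k}{N},\ \sin\tfrac{2\pi k}{N},\ 0\right)\quad(1\le k\le N).$$ Then the quantity in parentheses below is nonnegative, and with $$\omega_0=\pm\left(\frac{\theta_\alpha+\alpha}{(\sqrt{\lambda^2-1}\,r_0)^{\alpha+2}}-\frac{\theta_\beta+\beta}{(\sqrt{\lambda^2-1}\,r_0)^{\beta+2}}+\frac{2\alpha}{(\lambda r_0)^{\alpha+2}}-\frac{2\beta}{(\lambda r_0)^{\beta+2}}\right)^{\frac12}$$ (either choice of sign), the function $q(t)=E_{\omega_0}(t)q$, $t\in\mathbb{R}$, is a (homographic) solution of the $(3+N)$-body generalized Lennard-Jones system.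
   Context: Generalized Lennard-Jones system with $M$ bodies of unit mass and exponents $0<\alpha<\beta$: the positions $x_1,\dots,x_M\in\mathbb{R}^3$ (pairwise distinct, with $\sum_k x_k=0$) satisfy $$\ddot x_k=\sum_{j\ne k}\left(\frac{\beta}{|x_k-x_j|^{\beta+2}}-\frac{\alpha}{|x_k-x_j|^{\alpha+2}}\right)(x_k-x_j),\qquad k=1,\dots,M,$$ i.e. $\ddot x=-\nabla U(x)$ with $U(x)=\sum_{k<j}\left(|x_k-x_j|^{-\beta}-|x_k-x_j|^{-\alpha}\right)$. The $(3+N)$-body system is the case $M=3+N$. A solution is homographic if it has the form $r(t)R(t)x^0$ with $r(t)>0$, $R(t)\in SO(3)$ acting on each body separately, and $x^0$ a fixed configuration. For $c\in\mathbb{R}$, $E_c(t)=\begin{pmatrix}\cos ct&-\sin ct&0\\ \sin ct&\cos ct&0\\0&0&1\end{pmatrix}$, acting on each body's position separately. Constants, with $\omega_j=2\pi j/N$ and $\mathrm{i}^2=-1$: $$\theta_\beta=\frac{\beta}{2}\sum_{j=1}^{N-1}\frac{1}{|1-e^{\mathrm{i}\omega_j}|^{\beta}},\qquad \theta_\alpha=\frac{\alpha}{2}\sum_{j=1}^{N-1}\frac{1}{|1-e^{\mathrm{i}\omega_j}|^{\alpha}}.$$ For $\lambda\ge2$, $$G_2(\lambda)=\frac{\sqrt{\lambda^2-1}}{2\lambda}\left(\frac{\beta(2^{\beta+2}\lambda^{\beta+2}+2\lambda^{\beta+2}+2^{\beta+2}N)}{\alpha(2^{\alpha+2}\lambda^{\alpha+2}+2\lambda^{\alpha+2}+2^{\alpha+2}N)}\right)^{\frac1{\beta-\alpha}}.$$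 *)

theory Defs
  imports "HOL-Analysis.Analysis"
begin

(* Configurations of M bodies in R^3 are maps nat => real^3, of which only the
   values at the indices 1..M are relevant. *)

definition lj_force ::
  "real \<Rightarrow> real \<Rightarrow> nat \<Rightarrow> (nat \<Rightarrow> real^3) \<Rightarrow> nat \<Rightarrow> real^3" where
  "lj_force \<alpha> \<beta> M x k =
     (\<Sum>j\<in>{1..M} - {k}.
        (\<beta> / norm (x k - x j) powr (\<beta> + 2) - \<alpha> / norm (x k - x j) powr (\<alpha> + 2))
          *\<^sub>R (x k - x j))"

definition lj_admissible :: "nat \<Rightarrow> (nat \<Rightarrow> real^3) \<Rightarrow> bool" where
  "lj_admissible M x \<longleftrightarrow> inj_on x {1..M} \<and> (\<Sum>k=1..M. x k) = 0"

(* v is the velocity. *)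
definition lj_solution ::
  "real \<Rightarrow> real \<Rightarrow> nat \<Rightarrow> (real \<Rightarrow> nat \<Rightarrow> real^3) \<Rightarrow> bool" where
  "lj_solution \<alpha> \<beta> M x \<longleftrightarrow>
     (\<forall>t. lj_admissible M (x t)) \<and>
     (\<exists>v :: real \<Rightarrow> nat \<Rightarrow> real^3. \<forall>t. \<forall>k\<in>{1..M}.
        ((\<lambda>s. x s k) has_vector_derivative v t k) (at t) \<and>
        ((\<lambda>s. v s k) has_vector_derivative lj_force \<alpha> \<beta> M (x t) k) (at t))"

definition homographic :: "nat \<Rightarrow> (real \<Rightarrow> nat \<Rightarrow> real^3) \<Rightarrow> bool" where
  "homographic M x \<longleftrightarrow>
     (\<exists>(r :: real \<Rightarrow> real) (R :: real \<Rightarrow> real^3^3) (x0 :: nat \<Rightarrow> real^3).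
        \<forall>t. r t > 0 \<and> rotation_matrix (R t) \<and>
          (\<forall>k\<in>{1..M}. x t k = r t *\<^sub>R (R t *v x0 k)))"

definition E_rot :: "real \<Rightarrow> real \<Rightarrow> real^3^3" where
  "E_rot c t =
     vector [vector [cos (c * t), - sin (c * t), 0],
             vector [sin (c * t),   cos (c * t), 0],
             vector [0, 0, 1]]"

(* The constants theta_alpha and theta_beta are lj_theta N alpha and lj_theta N beta. *)
definition lj_theta :: "nat \<Rightarrow> real \<Rightarrow> real" where
  "lj_theta N \<gamma> =
     \<gamma> / 2 * (\<Sum>j=1..N-1. 1 / cmod (1 - exp (\<i> * of_real (2 * pi * real j / real N))) powr \<gamma>)"

definition G2 :: "real \<Rightarrow> real \<Rightarrow> nat \<Rightarrow> real \<Rightarrow> real" where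
  "G2 \<alpha> \<beta> N l =
     sqrt (l\<^sup>2 - 1) / (2 * l) *
     ((\<beta> * (2 powr (\<beta> + 2) * l powr (\<beta> + 2) + 2 * l powr (\<beta> + 2) + 2 powr (\<beta> + 2) * real N)) /
      (\<alpha> * (2 powr (\<alpha> + 2) * l powr (\<alpha> + 2) + 2 * l powr (\<alpha> + 2) + 2 powr (\<alpha> + 2) * real N)))
     powr (1 / (\<beta> - \<alpha>))"

(* Indices 1, 2, 3 are the bodies Q_1, Q_2, Q_3 on the axis; index 3 + k is the
   body q_k of the regular N-gon of radius \<rho>. *)
definition config :: "nat \<Rightarrow> real \<Rightarrow> real \<Rightarrow> nat \<Rightarrow> real^3" where
  "config N r0 \<rho> i =
     (if i = 1 then vector [0, 0, r0]
      else if i = 2 then vector [0, 0, - r0]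
      else if i = 3 then vector [0, 0, 0]
      else \<rho> *\<^sub>R vector [cos (2 * pi * real (i - 3) / real N), sin (2 * pi * real (i - 3) / real N), 0])"

end

theory Submission
  imports Defs
begin

text \<open>
  The configuration is a relative equilibrium: the three bodies on the axis feel no force, and every
  vertex of the polygon feels a force that points along its own position with one common factor
  \<open>- W\<close>. Since the force commutes with rotations, uniform rotation about the axis at
  angular velocity \<open>\<omega>\<close> with \<open>\<omega>\<^sup>2 = W\<close> then solves the equations of motion
  (\<open>lj_solution_relative_equilibrium\<close>).

  On the axis, the forces of the polygon add up to an axial force because the roots of unity sum
  to \<open>0\<close>. The vanishing of the total force on the bodies at height \<open>\<plusminus> r0\<close> is,
  for given \<open>l\<close>, an equation between a multiple of \<open>r0 powr (- \<alpha> - 2)\<close> and a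
  multiple of \<open>r0 powr (- \<beta> - 2)\<close>; \<open>G2\<close> encodes its solution (\<open>G2_axis_balance\<close>).

  On a vertex, the forces of the other vertices have no tangential part, because reflecting the
  polygon in the diameter through that vertex permutes them. The radial part of a chord of the unit
  circle of length \<open>d\<close> is \<open>d\<^sup>2 / 2\<close>, which turns the exponent \<open>\<gamma> + 2\<close> of the
  force into the exponent \<open>\<gamma>\<close> of \<open>lj_theta\<close> (\<open>polygon_force_on_vertex\<close>).

  The polygon has radius \<open>\<rho> = G2 \<alpha> \<beta> N l\<close>. The two lower bounds on \<open>G2\<close> say
  precisely that attraction dominates repulsion at distance \<open>\<rho>\<close>, both among the vertices and
  between a vertex and the centre; the outer bodies on the axis are at the larger distance
  \<open>l * r0\<close> from a vertex, so \<open>W \<ge> 0\<close>. The bounds hold for large \<open>l\<close> because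
  \<open>G2\<close> grows at least linearly in \<open>l\<close> (\<open>G2_linear_lower_bound\<close>).
\<close>

section \<open>Planar and axial vectors\<close>

text \<open>The factor by which a body at distance \<open>d\<close> acts along the difference of positions;
  positive values mean repulsion.\<close>

definition lj_coeff :: "real \<Rightarrow> real \<Rightarrow> real \<Rightarrow> real" where
  "lj_coeff \<alpha> \<beta> d = \<beta> / d powr (\<beta> + 2) - \<alpha> / d powr (\<alpha> + 2)"

lemma lj_force_eq_lj_coeff:
  "lj_force \<alpha> \<beta> M x k =
     (\<Sum>j\<in>{1..M} - {k}. lj_coeff \<alpha> \<beta> (norm (x k - x j)) *\<^sub>R (x k - x j))"
  by (simp add: lj_force_def lj_coeff_def)

text \<open>The horizontal plane of the space, identified with the complex numbers so that rotation about
  the vertical axis becomes multiplication.\<close>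

definition planar :: "complex \<Rightarrow> real^3" where
  "planar z = vector [Re z, Im z, 0]"

text \<open>The point of the vertical axis at a given height.\<close>

definition axial :: "real \<Rightarrow> real^3" where
  "axial h = vector [0, 0, h]"

lemma linear_planar: "linear planar"
  by (rule linearI) (simp_all add: planar_def vec_eq_iff forall_3)

lemmas planar_diff = linear_diff[OF linear_planar]
  and planar_sum = linear_sum[OF linear_planar]
  and planar_scaleR = linear_scale[OF linear_planar]
  and planar_0 = linear_0[OF linear_planar]

lemma linear_axial: "linear axial"
  by (rule linearI) (simp_all add: axial_def vec_eq_iff forall_3)

lemmas axial_diff = linear_diff[OF linear_axial]
  and axial_add = linear_add[OF linear_axial]
  and axial_scaleR = linear_scale[OF linear_axial]
  and axial_0 = linear_0[OF linear_axial]
  and axial_minus = linear_neg[OF linear_axial]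

lemma norm_axial_diff_planar: "norm (axial h - planar z) = sqrt (h\<^sup>2 + (cmod z)\<^sup>2)"
proof -
  have "norm v = sqrt ((v $ 1)\<^sup>2 + (v $ 2)\<^sup>2 + (v $ 3)\<^sup>2)" for v :: "real^3"
    by (simp add: norm_eq_sqrt_inner inner_vec_def sum_3 power2_eq_square)
  then show ?thesis
    by (simp add: axial_def planar_def cmod_power2)
qed

lemma norm_planar: "norm (planar z) = cmod z"
  using norm_axial_diff_planar[of 0 z] by (simp add: axial_0)

lemma norm_axial: "norm (axial h) = \<bar>h\<bar>"
  using norm_axial_diff_planar[of h 0] by (simp add: planar_0)

lemma planar_eq_iff: "planar z = planar w \<longleftrightarrow> z = w"
  by (simp add: planar_def vec_eq_iff forall_3 complex_eq_iff)

lemma axial_eq_iff: "axial a = axial b \<longleftrightarrow> a = b"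
  by (simp add: axial_def vec_eq_iff forall_3)

lemma axial_neq_planar: "z \<noteq> 0 \<Longrightarrow> axial a \<noteq> planar z"
  by (auto simp: planar_def axial_def vec_eq_iff forall_3 complex_eq_iff)

section \<open>Relative equilibria\<close>

lemma rotation_matrix_E_rot: "rotation_matrix (E_rot c t)"
  unfolding rotation_matrix_def orthogonal_matrix
  by (simp add: E_rot_def det_3 matrix_matrix_mult_def transpose_def mat_def vec_eq_iff forall_3
      sum_3 flip: power2_eq_square)

lemma norm_E_rot: "norm (E_rot c t *v y) = norm y"
proof -
  have "orthogonal_transformation (\<lambda>y. E_rot c t *v y)"
    using rotation_matrix_E_rot[of c t]
    by (simp add: rotation_matrix_def orthogonal_transformation_matrix)
  then show ?thesis
    by (rule orthogonal_transformation_norm)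
qed

lemma E_rot_planar: "E_rot c t *v planar z = planar (cis (c * t) * z)"
  by (simp add: E_rot_def planar_def matrix_vector_mult_def vec_eq_iff forall_3 sum_3)

lemma E_rot_axial: "E_rot c t *v axial h = axial h"
  by (simp add: E_rot_def axial_def matrix_vector_mult_def vec_eq_iff forall_3 sum_3)

lemma lj_force_isometry:
  fixes A :: "real^3^3"
  assumes "\<And>y. norm (A *v y) = norm y"
  shows "lj_force \<alpha> \<beta> M (\<lambda>k. A *v x k) k = A *v lj_force \<alpha> \<beta> M x k"
  unfolding lj_force_eq_lj_coeff
  by (simp add: linear_sum[OF matrix_vector_mul_linear] assms matrix_vector_mult_scaleR
      flip: matrix_vector_mult_diff_distrib)

lemma planar_rotation_has_vector_derivative:
  "((\<lambda>s. planar (cis (c * s) * z)) has_vector_derivative planar (cis (c * t) * (\<i> * of_real c * z))) (at t)"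
proof -
  have "bounded_linear planar"
    using linear_planar linear_conv_bounded_linear by blast
  moreover have "((\<lambda>s. cis (c * s) * z) has_vector_derivative cis (c * t) * (\<i> * of_real c * z)) (at t)"
    unfolding has_vector_derivative_def
    by (auto intro!: derivative_eq_intros simp: scaleR_conv_of_real algebra_simps)
  ultimately show ?thesis
    by (rule bounded_linear.has_vector_derivative)
qed

text \<open>A rotating planar vector has acceleration \<open>- \<omega>\<^sup>2\<close> times itself and an axial one has
  none, so a force of this shape at one instant is enough: equivariance under rotations carries it
  along the motion.\<close>

lemma lj_solution_relative_equilibrium:
  fixes z :: "nat \<Rightarrow> complex" and h :: "nat \<Rightarrow> real"
  defines "x \<equiv> \<lambda>k. planar (z k) + axial (h k)"
  assumes adm: "lj_admissible M x"
    and force: "\<And>k. k \<in> {1..M} \<Longrightarrow> lj_force \<alpha> \<beta> M x k = - \<omega>\<^sup>2 *\<^sub>R planar (z k)"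
  shows "lj_solution \<alpha> \<beta> M (\<lambda>t k. E_rot \<omega> t *v x k)"
proof -
  have E: "E_rot \<omega> t *v x k = planar (cis (\<omega> * t) * z k) + axial (h k)" for t k
    by (simp add: x_def matrix_vector_right_distrib E_rot_planar E_rot_axial)
  have inj: "inj (\<lambda>y. E_rot \<omega> t *v y)" for t
  proof (rule injI)
    fix y y' assume "E_rot \<omega> t *v y = E_rot \<omega> t *v y'"
    then have "norm (E_rot \<omega> t *v (y - y')) = 0"
      by (simp add: matrix_vector_mult_diff_distrib)
    then show "y = y'" by (simp add: norm_E_rot)
  qed
  have "lj_admissible M (\<lambda>k. E_rot \<omega> t *v x k)" for t
    using adm inj_on_subset[OF inj[of t]] comp_inj_on[of x "{1..M}" "\<lambda>y. E_rot \<omega> t *v y"]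
    by (auto simp: lj_admissible_def comp_def matrix_vector_mul_linear
        simp flip: linear_sum[OF matrix_vector_mul_linear])
  moreover have "\<forall>t. \<forall>k\<in>{1..M}.
        ((\<lambda>s. E_rot \<omega> s *v x k) has_vector_derivative planar (cis (\<omega> * t) * (\<i> * of_real \<omega> * z k))) (at t) \<and>
        ((\<lambda>s. planar (cis (\<omega> * s) * (\<i> * of_real \<omega> * z k)))
          has_vector_derivative lj_force \<alpha> \<beta> M (\<lambda>k. E_rot \<omega> t *v x k) k) (at t)"
  proof (intro allI ballI conjI)
    fix t :: real and k assume k: "k \<in> {1..M}"
    show "((\<lambda>s. E_rot \<omega> s *v x k) has_vector_derivative planar (cis (\<omega> * t) * (\<i> * of_real \<omega> * z k))) (at t)"
      unfolding E using has_vector_derivative_add[OF planar_rotation_has_vector_derivative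
          has_vector_derivative_const] by simp
    have "lj_force \<alpha> \<beta> M (\<lambda>k. E_rot \<omega> t *v x k) k = E_rot \<omega> t *v (- \<omega>\<^sup>2 *\<^sub>R planar (z k))"
      using lj_force_isometry[OF norm_E_rot] force[OF k] by metis
    also have "\<dots> = planar (cis (\<omega> * t) * (\<i> * of_real \<omega> * (\<i> * of_real \<omega> * z k)))"
    proof -
      have "- \<omega>\<^sup>2 *\<^sub>R planar (z k) = planar (\<i> * of_real \<omega> * (\<i> * of_real \<omega> * z k))"
        by (simp only: flip: planar_scaleR)
           (simp add: scaleR_conv_of_real power2_eq_square algebra_simps)
      then show ?thesis by (simp add: E_rot_planar)
    qed
    finally show "((\<lambda>s. planar (cis (\<omega> * s) * (\<i> * of_real \<omega> * z k)))
          has_vector_derivative lj_force \<alpha> \<beta> M (\<lambda>k. E_rot \<omega> t *v x k) k) (at t)"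
      using planar_rotation_has_vector_derivative[of \<omega> "\<i> * of_real \<omega> * z k" t] by simp
  qed
  ultimately show ?thesis
    unfolding lj_solution_def by (intro conjI allI exI[of _ "\<lambda>t k. planar (cis (\<omega> * t) * (\<i> * of_real \<omega> * z k))"]) blast+
qed

lemma homographic_E_rot: "homographic M (\<lambda>t k. E_rot c t *v x k)"
  unfolding homographic_def
  by (rule exI[of _ "\<lambda>_. 1"], rule exI[of _ "E_rot c"], rule exI[of _ x])
     (simp add: rotation_matrix_E_rot)

section \<open>The regular polygon\<close>

text \<open>The vertices of the regular polygon with \<open>N\<close> corners in the unit circle, for
  \<open>N \<ge> 1\<close>. The index set \<open>{1..N}\<close> enumerates them once, the last vertex being \<open>1\<close>.\<close>

definition zeta :: "nat \<Rightarrow> nat \<Rightarrow> complex" where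
  "zeta N j = cis (2 * pi * real j / real N)"

lemma zeta_add: "zeta N (j + k) = zeta N j * zeta N k"
  by (simp add: zeta_def cis_mult add_divide_distrib distrib_left)

lemma norm_zeta [simp]: "cmod (zeta N j) = 1"
  by (simp add: zeta_def)

lemma zeta_nonzero [simp]: "zeta N j \<noteq> 0"
  by (metis norm_zeta norm_zero zero_neq_one)

lemma zeta_self: "0 < N \<Longrightarrow> zeta N N = 1"
  by (simp add: zeta_def)

lemma inj_on_zeta:
  assumes "0 < N" shows "inj_on (zeta N) {1..N}"
proof -
  have "inj_on (zeta N) {..<N}"
    using Complex.bij_betw_roots_unity[OF assms] by (simp add: bij_betw_def zeta_def[abs_def])
  moreover have "zeta N (Suc i) = zeta N (Suc j) \<longleftrightarrow> zeta N i = zeta N j" for i j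
    using zeta_add[of N i 1] zeta_add[of N j 1] by simp
  ultimately have "inj_on (zeta N) (Suc ` {..<N})"
    by (auto simp: inj_on_def)
  then show ?thesis
    by (simp add: lessThan_Suc_atMost image_Suc_lessThan)
qed

lemma sum_zeta:
  assumes "2 \<le> N" shows "(\<Sum>j=1..N. zeta N j) = 0"
proof -
  have "(\<Sum>j<N. zeta N j) = \<Sum>{z::complex. z ^ N = 1}"
    using Complex.bij_betw_roots_unity[of N] assms
    by (intro sum.reindex_bij_betw[of _ _ _ "\<lambda>z. z"]) (simp add: zeta_def)
  also have "\<dots> = 0"
    using assms by (intro sum_roots_unity) simp
  finally have "(\<Sum>j<N. zeta N j) = 0" .
  moreover have "(\<Sum>j=1..N. zeta N j) = (\<Sum>j<N. zeta N (Suc j))"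
    by (rule sum.reindex_bij_witness[of _ Suc "\<lambda>j. j - 1"]) auto
  moreover have "\<dots> = zeta N 1 * (\<Sum>j<N. zeta N j)"
    by (simp add: sum_distrib_left flip: zeta_add)
  ultimately show ?thesis by simp
qed

text \<open>By the rotational symmetry of the polygon, the vertices other than the one of index
  \<open>k\<close> are its images under the nontrivial rotations of the polygon.\<close>

lemma sum_polygon_seen_from_vertex:
  assumes k: "k \<in> {1..N}"
  shows "(\<Sum>j\<in>{1..N} - {k}. F (zeta N j)) = (\<Sum>m=1..N-1. F (zeta N k * zeta N m))"
proof (rule sum.reindex_bij_witness[of _
      "\<lambda>m. if k + m \<le> N then k + m else k + m - N" "\<lambda>j. if k < j then j - k else j + N - k"])
  fix j assume j: "j \<in> {1..N} - {k}"
  show "F (zeta N k * zeta N (if k < j then j - k else j + N - k)) = F (zeta N j)"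
    using j k zeta_add[of N j N] zeta_self[of N] by (auto simp flip: zeta_add)
qed (use k in \<open>auto split: if_splits\<close>)

text \<open>The sum is real since the reflection \<open>m \<mapsto> N - m\<close> conjugates the chords and preserves
  their lengths; the real part of a chord \<open>1 - w\<close> with \<open>cmod w = 1\<close> is half the square of
  its length.\<close>

lemma sum_chords_weighted:
  assumes "0 < N"
  shows "(\<Sum>m=1..N-1. of_real (F (cmod (1 - zeta N m))) * (1 - zeta N m))
       = of_real (\<Sum>m=1..N-1. F (cmod (1 - zeta N m)) * (cmod (1 - zeta N m))\<^sup>2 / 2)"
    (is "?S = of_real ?T")
proof -
  have cnj: "zeta N (N - m) = cnj (zeta N m)" if "m \<in> {1..N-1}" for m
  proof -
    have "zeta N (N - m) * zeta N m = 1"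
      using that assms zeta_self[of N] zeta_add[of N "N - m" m] by auto
    moreover have "cnj (zeta N m) * zeta N m = 1"
      by (metis cis_cnj cis_mult cis_zero left_minus zeta_def)
    ultimately show ?thesis
      by (metis mult_right_cancel zeta_nonzero)
  qed
  have cmod_cnj: "cmod (1 - cnj w) = cmod (1 - w)" for w
    by (metis complex_cnj_diff complex_cnj_one complex_mod_cnj)
  have "?S = (\<Sum>m=1..N-1. of_real (F (cmod (1 - zeta N (N - m)))) * (1 - zeta N (N - m)))"
    by (rule sum.reindex_bij_witness[of _ "\<lambda>m. N - m" "\<lambda>m. N - m"]) auto
  also have "\<dots> = cnj ?S"
    by (simp add: cnj cmod_cnj)
  finally have "?S + ?S = ?S + cnj ?S" by simp
  also have "\<dots> = of_real (2 * Re ?S)"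
    by (rule complex_add_cnj)
  finally have "?S = of_real (Re ?S)" by simp
  also have "Re ?S = ?T"
  proof -
    have re: "Re (1 - zeta N m) = (cmod (1 - zeta N m))\<^sup>2 / 2" for m
    proof -
      have "(Re (zeta N m))\<^sup>2 + (Im (zeta N m))\<^sup>2 = 1"
        by (metis cmod_power2 norm_zeta one_power2)
      then show ?thesis
        by (simp add: cmod_power2 power2_diff)
    qed
    show ?thesis by (simp add: re del: minus_complex.sel)
  qed
  finally show ?thesis .
qed

section \<open>Forces in the configuration\<close>

lemma lj_theta_eq_zeta:
  "lj_theta N \<gamma> = \<gamma> / 2 * (\<Sum>m=1..N-1. 1 / cmod (1 - zeta N m) powr \<gamma>)"
  by (simp add: lj_theta_def zeta_def cis_conv_exp)

lemma lj_theta_pos: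
  assumes "2 \<le> N" "0 < \<gamma>" shows "0 < lj_theta N \<gamma>"
proof -
  have "zeta N m \<noteq> 1" if "m \<in> {1..N-1}" for m
  proof
    assume "zeta N m = 1"
    then have "zeta N m = zeta N N"
      using assms by (simp add: zeta_self)
    moreover have "m \<in> {1..N}" "N \<in> {1..N}" "m \<noteq> N"
      using that assms(1) by auto
    ultimately show False
      using inj_on_zeta[of N] assms by (auto dest: inj_onD)
  qed
  then have "0 < (\<Sum>m=1..N-1. 1 / cmod (1 - zeta N m) powr \<gamma>)"
    using assms by (intro sum_pos) auto
  then show ?thesis
    using assms by (simp add: lj_theta_eq_zeta)
qed

text \<open>All vertices are equidistant from a point of the axis, and their horizontal contributions
  cancel.\<close>

lemma polygon_force_on_axis:
  assumes "2 \<le> N"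
  shows "(\<Sum>j=1..N. lj_coeff \<alpha> \<beta> (norm (axial h - planar (of_real \<rho> * zeta N j)))
            *\<^sub>R (axial h - planar (of_real \<rho> * zeta N j)))
       = (real N * lj_coeff \<alpha> \<beta> (sqrt (h\<^sup>2 + \<rho>\<^sup>2))) *\<^sub>R axial h"
proof -
  have "(\<Sum>j=1..N. planar (of_real \<rho> * zeta N j)) = 0"
    using sum_zeta[OF assms] by (simp add: planar_0 flip: planar_sum sum_distrib_left)
  then show ?thesis
    by (simp add: norm_axial_diff_planar norm_mult sum_subtractf sum_constant_scaleR
        mult.commute del: sum_constant flip: scaleR_sum_right)
qed

lemma sum_chords_lj_coeff:
  assumes "0 < \<rho>"
  shows "(\<Sum>m=1..N-1. lj_coeff \<alpha> \<beta> (\<rho> * cmod (1 - zeta N m)) * (cmod (1 - zeta N m))\<^sup>2 / 2)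
       = lj_theta N \<beta> / \<rho> powr (\<beta> + 2) - lj_theta N \<alpha> / \<rho> powr (\<alpha> + 2)"
proof -
  have "\<gamma> / (\<rho> * d) powr (\<gamma> + 2) * d\<^sup>2 / 2 = \<gamma> / 2 * (1 / d powr \<gamma>) / \<rho> powr (\<gamma> + 2)"
    if "0 \<le> d" for d \<gamma> :: real
    \<comment> \<open>For \<open>d = 0\<close> both sides vanish, the right one because \<open>1 / 0 = 0\<close>.\<close>
    using that assms by (cases "d = 0") (auto simp: powr_mult powr_add)
  then have "lj_coeff \<alpha> \<beta> (\<rho> * d) * d\<^sup>2 / 2
      = \<beta> / 2 * (1 / d powr \<beta>) / \<rho> powr (\<beta> + 2) - \<alpha> / 2 * (1 / d powr \<alpha>) / \<rho> powr (\<alpha> + 2)"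
    if "0 \<le> d" for d
    using that by (simp add: lj_coeff_def left_diff_distrib diff_divide_distrib)
  then show ?thesis
    by (simp only: norm_ge_zero sum_subtractf lj_theta_eq_zeta sum_distrib_left sum_divide_distrib)
qed

lemma polygon_force_on_vertex:
  assumes \<rho>: "0 < \<rho>" and k: "k \<in> {1..N}"
  shows "(\<Sum>j\<in>{1..N} - {k}.
            lj_coeff \<alpha> \<beta> (norm (planar (of_real \<rho> * zeta N k) - planar (of_real \<rho> * zeta N j)))
            *\<^sub>R (planar (of_real \<rho> * zeta N k) - planar (of_real \<rho> * zeta N j)))
       = (lj_theta N \<beta> / \<rho> powr (\<beta> + 2) - lj_theta N \<alpha> / \<rho> powr (\<alpha> + 2))
            *\<^sub>R planar (of_real \<rho> * zeta N k)"
    (is "?L = _")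
proof -
  let ?w = "of_real \<rho> * zeta N k"
  let ?F = "\<lambda>d. lj_coeff \<alpha> \<beta> (\<rho> * d)"
  have "?L = planar (\<Sum>j\<in>{1..N} - {k}.
      of_real (lj_coeff \<alpha> \<beta> (cmod (?w - of_real \<rho> * zeta N j))) * (?w - of_real \<rho> * zeta N j))"
    by (simp add: planar_sum norm_planar flip: planar_diff planar_scaleR scaleR_conv_of_real)
  also have "\<dots> = planar (\<Sum>m=1..N-1.
      of_real (lj_coeff \<alpha> \<beta> (cmod (?w - of_real \<rho> * (zeta N k * zeta N m))))
        * (?w - of_real \<rho> * (zeta N k * zeta N m)))"
    by (subst sum_polygon_seen_from_vertex[OF k]) (rule refl)
  also have "(\<Sum>m=1..N-1.
      of_real (lj_coeff \<alpha> \<beta> (cmod (?w - of_real \<rho> * (zeta N k * zeta N m))))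
        * (?w - of_real \<rho> * (zeta N k * zeta N m)))
      = (\<Sum>m=1..N-1. of_real (lj_coeff \<alpha> \<beta> (cmod (?w * (1 - zeta N m)))) * (?w * (1 - zeta N m)))"
    by (simp only: right_diff_distrib mult_1_right mult.assoc)
  also have "\<dots> = ?w * (\<Sum>m=1..N-1. of_real (?F (cmod (1 - zeta N m))) * (1 - zeta N m))"
    using \<rho> by (simp add: norm_mult sum_distrib_left mult_ac)
  also have "\<dots> = (lj_theta N \<beta> / \<rho> powr (\<beta> + 2) - lj_theta N \<alpha> / \<rho> powr (\<alpha> + 2)) *\<^sub>R ?w"
  proof -
    have "0 < N" using k by simp
    then show ?thesis
      by (simp only: sum_chords_weighted[of N ?F] sum_chords_lj_coeff[OF \<rho>]
          scaleR_conv_of_real) (rule mult.commute)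
  qed
  finally show ?thesis
    by (simp only: planar_scaleR)
qed

lemma config_decomposition:
  "config N r0 \<rho> i =
     planar (if i \<in> {1, 2, 3} then 0 else of_real \<rho> * zeta N (i - 3)) +
     axial (if i = 1 then r0 else if i = 2 then - r0 else 0)"
  by (auto simp: config_def planar_def axial_def zeta_def vec_eq_iff forall_3)

lemma config_axis:
  "config N r0 \<rho> 1 = axial r0" "config N r0 \<rho> 2 = axial (- r0)" "config N r0 \<rho> 3 = axial 0"
  by (simp_all add: config_def axial_def)

lemma config_vertex: "0 < k \<Longrightarrow> config N r0 \<rho> (3 + k) = planar (of_real \<rho> * zeta N k)"
  by (simp add: config_decomposition axial_0)

lemma atLeast1_3_plus: "{1..3 + N} = {1, 2, 3} \<union> (+) (3::nat) ` {1..N}"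
  by auto

text \<open>The index set splits into the three bodies on the axis and the shifted indices of the
  vertices.\<close>

lemma sum_bodies:
  fixes f :: "nat \<Rightarrow> 'a::comm_monoid_add"
  assumes "A \<subseteq> {1, 2, 3}" "B \<subseteq> {1..N}"
  shows "sum f (A \<union> (+) 3 ` B) = sum f A + (\<Sum>j\<in>B. f (3 + j))"
proof -
  have "finite A" "finite B"
    using assms by (auto intro: finite_subset)
  moreover have "n \<le> 3" if "n \<in> A" for n
    using that assms(1) by auto
  moreover have "1 \<le> n" if "n \<in> B" for n
    using that assms(2) by auto
  then have "A \<inter> (+) 3 ` B = {}"
    using calculation(3) by fastforce
  ultimately show ?thesis
    by (simp add: sum.union_disjoint sum.reindex)
qed

lemma lj_admissible_config:
  assumes "0 < r0" "0 < \<rho>" "2 \<le> N"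
  shows "lj_admissible (3 + N) (config N r0 \<rho>)"
  unfolding lj_admissible_def
proof
  have "inj_on (config N r0 \<rho>) {1, 2, 3}"
    using assms by (auto simp: inj_on_def config_axis axial_eq_iff simp del: One_nat_def)
  moreover have "inj_on (config N r0 \<rho>) ((+) 3 ` {1..N})"
  proof (rule inj_onI, clarify)
    fix a b assume ab: "a \<in> {1..N}" "b \<in> {1..N}" "config N r0 \<rho> (3 + a) = config N r0 \<rho> (3 + b)"
    then have "zeta N a = zeta N b"
      using assms(2) by (simp add: config_vertex planar_eq_iff)
    then show "3 + a = 3 + b"
      using inj_on_zeta[of N] assms(3) ab(1,2) by (auto dest: inj_onD)
  qed
  moreover have "config N r0 \<rho> i \<noteq> config N r0 \<rho> (3 + k)" if ik: "i \<in> {1, 2, 3}" "k \<in> {1..N}" for i k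
  proof -
    have "config N r0 \<rho> (3 + k) = planar (of_real \<rho> * zeta N k)"
      using ik(2) by (simp add: config_vertex)
    moreover obtain h where "config N r0 \<rho> i = axial h"
      using ik(1) by (auto simp: config_axis simp del: One_nat_def)
    ultimately show ?thesis
      using assms(2) by (simp add: axial_neq_planar)
  qed
  ultimately show "inj_on (config N r0 \<rho>) {1..3 + N}"
    unfolding atLeast1_3_plus inj_on_Un by blast
  have "(\<Sum>j=1..N. config N r0 \<rho> (3 + j)) = planar (of_real \<rho> * (\<Sum>j=1..N. zeta N j))"
    by (simp add: config_vertex planar_sum sum_distrib_left)
  moreover have "sum (config N r0 \<rho>) {1, 2, 3} = axial r0 + (axial (- r0) + axial 0)"
    by (simp only: flip: config_axis[of N r0 \<rho>]) simp
  moreover have "sum (config N r0 \<rho>) {1..3 + N}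
      = sum (config N r0 \<rho>) {1, 2, 3} + (\<Sum>j=1..N. config N r0 \<rho> (3 + j))"
    unfolding atLeast1_3_plus by (rule sum_bodies[where N = N]) auto
  ultimately show "sum (config N r0 \<rho>) {1..3 + N} = 0"
    using sum_zeta[OF assms(3)] by (simp add: planar_0 axial_minus axial_0)
qed

text \<open>The assumption \<open>balance\<close> is the equilibrium of the bodies at heights \<open>\<plusminus> r0\<close>:
  the terms come from the opposite body, from the centre and from the polygon. For the body in the
  centre the force vanishes by symmetry.\<close>

lemma lj_force_config_axis:
  assumes "0 < r0" "2 \<le> N" "i \<in> {1, 2, 3}"
    and balance: "2 * lj_coeff \<alpha> \<beta> (2 * r0) + lj_coeff \<alpha> \<beta> r0
                  + real N * lj_coeff \<alpha> \<beta> (sqrt (r0\<^sup>2 + \<rho>\<^sup>2)) = 0"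
  shows "lj_force \<alpha> \<beta> (3 + N) (config N r0 \<rho>) i = 0"
proof -
  let ?q = "config N r0 \<rho>"
  let ?f = "\<lambda>j. lj_coeff \<alpha> \<beta> (norm (?q i - ?q j)) *\<^sub>R (?q i - ?q j)"
  have "{1..3 + N} - {i} = ({1, 2, 3} - {i}) \<union> (+) 3 ` {1..N}"
    using assms(3) unfolding atLeast1_3_plus by auto
  then have "lj_force \<alpha> \<beta> (3 + N) ?q i = sum ?f ({1, 2, 3} - {i}) + (\<Sum>j=1..N. ?f (3 + j))"
    by (simp only: lj_force_eq_lj_coeff) (rule sum_bodies[where N = N], auto)
  moreover obtain h where h: "?q i = axial h"
    using assms(3) by (auto simp: config_axis simp del: One_nat_def)
  then have "(\<Sum>j=1..N. ?f (3 + j)) = axial (real N * lj_coeff \<alpha> \<beta> (sqrt (h\<^sup>2 + \<rho>\<^sup>2)) * h)"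
    using polygon_force_on_axis[OF assms(2), of \<alpha> \<beta> h \<rho>] axial_scaleR[of _ h]
    by (simp add: config_vertex)
  moreover have pair: "lj_coeff \<alpha> \<beta> (norm (axial a - axial b)) *\<^sub>R (axial a - axial b)
      = axial (lj_coeff \<alpha> \<beta> \<bar>a - b\<bar> * (a - b))" for a b
    using axial_scaleR[of _ "a - b"] by (simp add: norm_axial flip: axial_diff)
  have f: "?f 1 = axial (lj_coeff \<alpha> \<beta> \<bar>h - r0\<bar> * (h - r0))"
      "?f 2 = axial (lj_coeff \<alpha> \<beta> \<bar>h + r0\<bar> * (h + r0))"
      "?f 3 = axial (lj_coeff \<alpha> \<beta> \<bar>h\<bar> * h)"
    using pair[of h r0] pair[of h "- r0"] pair[of h 0] by (simp_all only: h config_axis) simp_all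
  have sum_two: "sum g {a, b} = g a + g b" if "a \<noteq> b" for g :: "nat \<Rightarrow> real^3" and a b
    using that by simp
  consider "i = 1" "h = r0" "{1, 2, 3} - {i} = {2, 3}"
    | "i = 2" "h = - r0" "{1, 2, 3} - {i} = {1, 3}"
    | "i = 3" "h = 0" "{1, 2, 3} - {i} = {1, 2}"
    using assms(3) h
    by (auto simp: config_axis axial_eq_iff insert_Diff_if simp del: One_nat_def)
  then have "sum ?f ({1, 2, 3} - {i})
      = axial ((2 * lj_coeff \<alpha> \<beta> (2 * r0) + lj_coeff \<alpha> \<beta> r0) * h)"
  proof cases
    case 1
    have "sum ?f ({1, 2, 3} - {i}) = ?f 2 + ?f 3"
      unfolding 1(3) by (rule sum_two) simp
    then show ?thesis
      using assms(1) 1(2) by (simp only: f flip: axial_add) (simp add: algebra_simps)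
  next
    case 2
    have "sum ?f ({1, 2, 3} - {i}) = ?f 1 + ?f 3"
      unfolding 2(3) by (rule sum_two) simp
    then show ?thesis
      using assms(1) 2(2) by (simp only: f flip: axial_add) (simp add: algebra_simps)
  next
    case 3
    have "sum ?f ({1, 2, 3} - {i}) = ?f 1 + ?f 2"
      unfolding 3(3) by (rule sum_two) simp
    then show ?thesis
      using assms(1) 3(2) by (simp only: f flip: axial_add) simp
  qed
  moreover have "h\<^sup>2 = r0\<^sup>2 \<or> h = 0"
    using assms(3) h by (auto simp: config_axis axial_eq_iff simp del: One_nat_def)
  \<comment> \<open>For the body in the centre, \<open>h = 0\<close> and the factor in parentheses does not matter.\<close>
  ultimately have "lj_force \<alpha> \<beta> (3 + N) ?q i = axial ((2 * lj_coeff \<alpha> \<beta> (2 * r0) + lj_coeff \<alpha> \<beta> r0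
                  + real N * lj_coeff \<alpha> \<beta> (sqrt (r0\<^sup>2 + \<rho>\<^sup>2))) * h)"
    by (auto simp: distrib_right simp flip: axial_add)
  then show ?thesis
    by (simp only: balance mult_zero_left axial_0)
qed

text \<open>The summands in the factor come from the other vertices, from the centre and from the two
  outer bodies on the axis, whose vertical contributions cancel.\<close>

lemma lj_force_config_vertex:
  assumes "0 < \<rho>" "k \<in> {1..N}"
  shows "lj_force \<alpha> \<beta> (3 + N) (config N r0 \<rho>) (3 + k) =
    (lj_theta N \<beta> / \<rho> powr (\<beta> + 2) - lj_theta N \<alpha> / \<rho> powr (\<alpha> + 2)
       + lj_coeff \<alpha> \<beta> \<rho> + 2 * lj_coeff \<alpha> \<beta> (sqrt (r0\<^sup>2 + \<rho>\<^sup>2))) *\<^sub>R config N r0 \<rho> (3 + k)"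
proof -
  let ?q = "config N r0 \<rho>"
  let ?f = "\<lambda>j. lj_coeff \<alpha> \<beta> (norm (?q (3 + k) - ?q j)) *\<^sub>R (?q (3 + k) - ?q j)"
  have "{1..3 + N} - {3 + k} = {1, 2, 3} \<union> (+) 3 ` ({1..N} - {k})"
    using assms(2) unfolding atLeast1_3_plus by (auto simp: image_set_diff)
  then have split: "lj_force \<alpha> \<beta> (3 + N) ?q (3 + k) = sum ?f {1, 2, 3} + (\<Sum>j\<in>{1..N} - {k}. ?f (3 + j))"
    by (simp only: lj_force_eq_lj_coeff) (rule sum_bodies[where N = N], auto)
  have ring: "(\<Sum>j\<in>{1..N} - {k}. ?f (3 + j)) =
      (lj_theta N \<beta> / \<rho> powr (\<beta> + 2) - lj_theta N \<alpha> / \<rho> powr (\<alpha> + 2)) *\<^sub>R ?q (3 + k)"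
    using polygon_force_on_vertex[OF assms, of \<alpha> \<beta>] assms(2) by (simp add: config_vertex)
  have "norm (?q (3 + k) - axial h) = sqrt (h\<^sup>2 + \<rho>\<^sup>2)" for h
    using assms by (simp add: config_vertex norm_axial_diff_planar norm_minus_commute norm_mult)
  then have pair: "lj_coeff \<alpha> \<beta> (norm (?q (3 + k) - axial h)) *\<^sub>R (?q (3 + k) - axial h)
      = lj_coeff \<alpha> \<beta> (sqrt (h\<^sup>2 + \<rho>\<^sup>2)) *\<^sub>R ?q (3 + k) - axial (lj_coeff \<alpha> \<beta> (sqrt (h\<^sup>2 + \<rho>\<^sup>2)) * h)" for h
    using axial_scaleR[of _ h] by (simp add: scaleR_diff_right)
  have sum3: "sum g {1, 2, 3} = g 1 + g 2 + g 3" for g :: "nat \<Rightarrow> real^3"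
    by (simp add: add.assoc)
  have axis: "sum ?f {1, 2, 3} = (lj_coeff \<alpha> \<beta> \<rho> + 2 * lj_coeff \<alpha> \<beta> (sqrt (r0\<^sup>2 + \<rho>\<^sup>2))) *\<^sub>R ?q (3 + k)"
  proof -
    have "(a *\<^sub>R v - w) + (a *\<^sub>R v - - w) + b *\<^sub>R v = (b + 2 * a) *\<^sub>R v" for a b and v w :: "real^3"
      by (simp only: scaleR_add_left scaleR_scaleR[symmetric] scaleR_2) simp
    then show ?thesis
      unfolding sum3 config_axis pair
      unfolding mult_minus_right power2_minus axial_minus
      using assms(1) by (simp add: axial_0)
  qed
  show ?thesis
    unfolding split ring axis by (simp only: scaleR_add_left add_ac)
qed

section \<open>Properties of the balance radius\<close>

text \<open>The common shape of the two expressions whose quotient occurs in \<open>G2\<close>.\<close>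

definition axis_weight :: "nat \<Rightarrow> real \<Rightarrow> real \<Rightarrow> real" where
  "axis_weight N l \<gamma> = 2 powr (\<gamma> + 2) * l powr (\<gamma> + 2) + 2 * l powr (\<gamma> + 2) + 2 powr (\<gamma> + 2) * real N"

lemma axis_weight_pos: "0 < l \<Longrightarrow> 0 < axis_weight N l \<gamma>"
  by (simp add: axis_weight_def add_pos_nonneg)

lemma G2_eq_axis_weight:
  "G2 \<alpha> \<beta> N l = sqrt (l\<^sup>2 - 1) / (2 * l) *
     (\<beta> * axis_weight N l \<beta> / (\<alpha> * axis_weight N l \<alpha>)) powr (1 / (\<beta> - \<alpha>))"
  by (simp add: G2_def axis_weight_def)

text \<open>With \<open>s = 2 * l * r0\<close>, the distances \<open>2 * r0\<close>, \<open>r0\<close> and \<open>l * r0\<close> are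
  \<open>s / l\<close>, \<open>s / (2 * l)\<close> and \<open>s / 2\<close>. Collecting the terms of exponent
  \<open>\<gamma> + 2\<close> therefore produces \<open>axis_weight N l \<gamma> / s powr (\<gamma> + 2)\<close>, and \<open>s\<close> is
  chosen to make the two exponents balance.\<close>

lemma G2_axis_balance:
  fixes N :: nat
  assumes "0 < \<alpha>" "\<alpha> < \<beta>" "2 \<le> l"
  defines "r0 \<equiv> G2 \<alpha> \<beta> N l / sqrt (l\<^sup>2 - 1)"
  shows "2 * lj_coeff \<alpha> \<beta> (2 * r0) + lj_coeff \<alpha> \<beta> r0 + real N * lj_coeff \<alpha> \<beta> (l * r0) = 0"
proof -
  define s where "s = (\<beta> * axis_weight N l \<beta> / (\<alpha> * axis_weight N l \<alpha>)) powr (1 / (\<beta> - \<alpha>))"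
  have pos: "0 < axis_weight N l \<alpha>" "0 < axis_weight N l \<beta>"
    using assms(3) by (simp_all add: axis_weight_pos)
  have s: "0 < s"
    using pos assms by (simp add: s_def)
  have "1 < l\<^sup>2"
    using assms(3) by (simp add: one_less_power)
  then have r0: "r0 = s / (2 * l)"
    by (simp add: r0_def G2_eq_axis_weight s_def)
  have "s powr (\<beta> - \<alpha>) = \<beta> * axis_weight N l \<beta> / (\<alpha> * axis_weight N l \<alpha>)"
    using pos assms by (simp add: s_def powr_powr)
  then have "\<beta> * axis_weight N l \<beta> = \<alpha> * axis_weight N l \<alpha> * s powr (\<beta> - \<alpha>)"
    using pos assms by (simp add: field_simps)
  moreover have "s powr (\<beta> + 2) = s powr (\<beta> - \<alpha>) * s powr (\<alpha> + 2)"
    by (simp flip: powr_add)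
  ultimately have eq: "\<beta> * axis_weight N l \<beta> / s powr (\<beta> + 2) = \<alpha> * axis_weight N l \<alpha> / s powr (\<alpha> + 2)"
    using s by simp
  have "2 / (2 * r0) powr (\<gamma> + 2) + 1 / r0 powr (\<gamma> + 2) + real N / (l * r0) powr (\<gamma> + 2)
      = axis_weight N l \<gamma> / s powr (\<gamma> + 2)" for \<gamma>
  proof -
    have "2 * r0 = s / l" "l * r0 = s / 2"
      using assms(3) by (auto simp: r0)
    then show ?thesis
      using assms(3) s by (simp add: r0 powr_divide powr_mult axis_weight_def add_divide_distrib mult_ac)
  qed
  note weight = this
  have "2 * lj_coeff \<alpha> \<beta> (2 * r0) + lj_coeff \<alpha> \<beta> r0 + real N * lj_coeff \<alpha> \<beta> (l * r0)
      = \<beta> * (axis_weight N l \<beta> / s powr (\<beta> + 2)) - \<alpha> * (axis_weight N l \<alpha> / s powr (\<alpha> + 2))"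
    by (simp only: weight[symmetric]) (simp add: lj_coeff_def algebra_simps)
  then show ?thesis
    using eq by simp
qed

text \<open>For \<open>l \<ge> 2\<close> the quotient inside \<open>G2\<close> is at least a positive constant times
  \<open>l powr (\<beta> - \<alpha>)\<close>, and the factor in front of it is at least \<open>1 / 4\<close>.\<close>

lemma G2_linear_lower_bound:
  assumes "0 < \<alpha>" "\<alpha> < \<beta>"
  obtains C where "0 < C" "\<And>l. 2 \<le> l \<Longrightarrow> C * l \<le> G2 \<alpha> \<beta> N l"
proof -
  define D where "D = \<beta> * 2 powr (\<beta> + 2) / (\<alpha> * (2 powr (\<alpha> + 2) + 2 + 2 powr (\<alpha> + 2) * real N))"
  have den: "0 < 2 powr (\<alpha> + 2) + 2 + 2 powr (\<alpha> + 2) * real N"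
    by (simp add: add_pos_nonneg)
  have D: "0 < D"
    using assms den by (simp add: D_def)
  define C where "C = D powr (1 / (\<beta> - \<alpha>)) / 4"
  have "C * l \<le> G2 \<alpha> \<beta> N l" if l: "2 \<le> l" for l
  proof -
    have "1 \<le> l powr (\<alpha> + 2)"
      using l assms by (intro ge_one_powr_ge_zero) auto
    then have "axis_weight N l \<alpha> \<le> (2 powr (\<alpha> + 2) + 2 + 2 powr (\<alpha> + 2) * real N) * l powr (\<alpha> + 2)"
      by (simp add: axis_weight_def algebra_simps mult_left_mono)
    moreover have "2 powr (\<beta> + 2) * l powr (\<beta> + 2) \<le> axis_weight N l \<beta>"
      by (simp add: axis_weight_def)
    moreover have "l powr (\<beta> + 2) = l powr (\<beta> - \<alpha>) * l powr (\<alpha> + 2)"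
      by (simp flip: powr_add)
    then have "D * l powr (\<beta> - \<alpha>) = \<beta> * (2 powr (\<beta> + 2) * l powr (\<beta> + 2)) /
        (\<alpha> * ((2 powr (\<alpha> + 2) + 2 + 2 powr (\<alpha> + 2) * real N) * l powr (\<alpha> + 2)))"
      using l by (simp add: D_def)
    ultimately have "D * l powr (\<beta> - \<alpha>) \<le> \<beta> * axis_weight N l \<beta> / (\<alpha> * axis_weight N l \<alpha>)"
      using l assms axis_weight_pos[of l N \<alpha>] axis_weight_pos[of l N \<beta>]
      by (simp only:) (intro frac_le mult_left_mono mult_pos_pos, auto)
    then have "(D * l powr (\<beta> - \<alpha>)) powr (1 / (\<beta> - \<alpha>))
        \<le> (\<beta> * axis_weight N l \<beta> / (\<alpha> * axis_weight N l \<alpha>)) powr (1 / (\<beta> - \<alpha>))"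
      using D assms by (intro powr_mono2) auto
    moreover have "(D * l powr (\<beta> - \<alpha>)) powr (1 / (\<beta> - \<alpha>)) = 4 * C * l"
      using l D assms by (simp add: C_def powr_mult powr_powr)
    moreover have "1 / 4 \<le> sqrt (l\<^sup>2 - 1) / (2 * l)"
    proof -
      have "(l / 2)\<^sup>2 \<le> l\<^sup>2 - 1"
        using mult_mono[of 2 l 2 l] l by (simp add: power2_eq_square)
      then have "l / 2 \<le> sqrt (l\<^sup>2 - 1)"
        by (rule real_le_rsqrt)
      then show ?thesis
        using l by (simp add: field_simps)
    qed
    ultimately have "1 / 4 * (4 * C * l) \<le> G2 \<alpha> \<beta> N l"
      unfolding G2_eq_axis_weight using l D by (intro mult_mono) (auto simp: C_def)
    then show ?thesis by simp
  qed
  moreover have "0 < C"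
    using D by (simp add: C_def)
  ultimately show ?thesis
    using that by blast
qed

text \<open>Beyond the distance at which \<open>b / \<rho> powr (\<beta> + 2)\<close> and \<open>a / \<rho> powr (\<alpha> + 2)\<close>
  agree, the term with the smaller exponent is the larger one.\<close>

lemma attraction_dominates:
  fixes a b \<alpha> \<beta> \<rho> :: real
  assumes "0 < a" "0 < b" "\<alpha> < \<beta>" "0 < \<rho>" "(b / a) powr (1 / (\<beta> - \<alpha>)) \<le> \<rho>"
  shows "b / \<rho> powr (\<beta> + 2) \<le> a / \<rho> powr (\<alpha> + 2)"
proof -
  have "((b / a) powr (1 / (\<beta> - \<alpha>))) powr (\<beta> - \<alpha>) \<le> \<rho> powr (\<beta> - \<alpha>)"
    using assms by (intro powr_mono2) auto
  then have "b \<le> a * \<rho> powr (\<beta> - \<alpha>)"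
    using assms by (simp add: powr_powr field_simps)
  moreover have "\<rho> powr (\<beta> + 2) = \<rho> powr (\<beta> - \<alpha>) * \<rho> powr (\<alpha> + 2)"
    by (simp flip: powr_add)
  ultimately show ?thesis
    using assms by (simp add: field_simps)
qed

section \<open>The homographic solutions\<close>

lemma lj_solution_rotating_config:
  assumes "0 < r0" "0 < \<rho>" "2 \<le> N"
    and balance: "2 * lj_coeff \<alpha> \<beta> (2 * r0) + lj_coeff \<alpha> \<beta> r0
                  + real N * lj_coeff \<alpha> \<beta> (sqrt (r0\<^sup>2 + \<rho>\<^sup>2)) = 0"
    and \<omega>: "\<omega>\<^sup>2 = lj_theta N \<alpha> / \<rho> powr (\<alpha> + 2) - lj_theta N \<beta> / \<rho> powr (\<beta> + 2)
       - lj_coeff \<alpha> \<beta> \<rho> - 2 * lj_coeff \<alpha> \<beta> (sqrt (r0\<^sup>2 + \<rho>\<^sup>2))"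
  shows "lj_solution \<alpha> \<beta> (3 + N) (\<lambda>t k. E_rot \<omega> t *v config N r0 \<rho> k)"
  unfolding config_decomposition
proof (rule lj_solution_relative_equilibrium, fold config_decomposition)
  show "lj_admissible (3 + N) (config N r0 \<rho>)"
    using assms by (intro lj_admissible_config)
  fix i assume "i \<in> {1..3 + N}"
  then consider "i \<in> {1, 2, 3}" | k where "i = 3 + k" "k \<in> {1..N}"
    unfolding atLeast1_3_plus by blast
  then show "lj_force \<alpha> \<beta> (3 + N) (config N r0 \<rho>) i =
      - \<omega>\<^sup>2 *\<^sub>R planar (if i \<in> {1, 2, 3} then 0 else of_real \<rho> * zeta N (i - 3))"
  proof cases
    case 1
    with lj_force_config_axis[OF assms(1,3) 1 balance] show ?thesis
      by (simp add: planar_0)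
  next
    case 2
    then have "planar (if i \<in> {1, 2, 3} then 0 else of_real \<rho> * zeta N (i - 3)) = config N r0 \<rho> i"
      by (auto simp: config_vertex)
    then show ?thesis
      using 2 lj_force_config_vertex[OF assms(2) 2(2), of \<alpha> \<beta> r0] by (simp add: \<omega>)
  qed
qed

theorem proposition1p2:
  fixes \<alpha> \<beta> :: real and N :: nat
  assumes "0 < \<alpha>" and "\<alpha> < \<beta>" and "N \<ge> 2"
  shows "\<exists>l2 :: real. l2 > 0 \<and>
    (\<forall>l\<ge>2. l \<ge> l2 \<longrightarrow>
       G2 \<alpha> \<beta> N l \<ge> max ((lj_theta N \<beta> / lj_theta N \<alpha>) powr (1 / (\<beta> - \<alpha>)))
                          ((\<beta> / \<alpha>) powr (1 / (\<beta> - \<alpha>)))) \<and>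
    (\<forall>l \<ge> max 2 l2.
       let r0 = G2 \<alpha> \<beta> N l / sqrt (l\<^sup>2 - 1);
           \<rho> = sqrt (l\<^sup>2 - 1) * r0;
           q = config N r0 \<rho>;
           W = (lj_theta N \<alpha> + \<alpha>) / \<rho> powr (\<alpha> + 2) - (lj_theta N \<beta> + \<beta>) / \<rho> powr (\<beta> + 2)
               + 2 * \<alpha> / (l * r0) powr (\<alpha> + 2) - 2 * \<beta> / (l * r0) powr (\<beta> + 2)
       in W \<ge> 0 \<and>
          (\<forall>\<omega>0 \<in> {sqrt W, - sqrt W}.
             lj_solution \<alpha> \<beta> (3 + N) (\<lambda>t k. E_rot \<omega>0 t *v q k) \<and>
             homographic (3 + N) (\<lambda>t k. E_rot \<omega>0 t *v q k)))"
proof -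
  define K where "K = max ((lj_theta N \<beta> / lj_theta N \<alpha>) powr (1 / (\<beta> - \<alpha>)))
                          ((\<beta> / \<alpha>) powr (1 / (\<beta> - \<alpha>)))"
  obtain C where C: "0 < C" "\<And>l. 2 \<le> l \<Longrightarrow> C * l \<le> G2 \<alpha> \<beta> N l"
    using G2_linear_lower_bound[OF assms(1,2)] by blast
  have large: "K \<le> G2 \<alpha> \<beta> N l" if "2 \<le> l" "max 1 (K / C) \<le> l" for l
  proof -
    have "K \<le> C * l"
      using that(2) C(1) by (simp add: field_simps)
    then show ?thesis
      using C(2)[OF that(1)] by simp
  qed
  have main: "W \<ge> 0 \<and> (\<forall>\<omega>0 \<in> {sqrt W, - sqrt W}.
             lj_solution \<alpha> \<beta> (3 + N) (\<lambda>t k. E_rot \<omega>0 t *v config N r0 \<rho> k) \<and>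
             homographic (3 + N) (\<lambda>t k. E_rot \<omega>0 t *v config N r0 \<rho> k))"
    if l: "2 \<le> l" and K: "K \<le> G2 \<alpha> \<beta> N l"
      and r0: "r0 = G2 \<alpha> \<beta> N l / sqrt (l\<^sup>2 - 1)" and \<rho>: "\<rho> = sqrt (l\<^sup>2 - 1) * r0"
      and W: "W = (lj_theta N \<alpha> + \<alpha>) / \<rho> powr (\<alpha> + 2) - (lj_theta N \<beta> + \<beta>) / \<rho> powr (\<beta> + 2)
               + 2 * \<alpha> / (l * r0) powr (\<alpha> + 2) - 2 * \<beta> / (l * r0) powr (\<beta> + 2)"
    for l r0 \<rho> W
  proof -
    have "1 < l\<^sup>2"
      using l by (simp add: one_less_power)
    have "0 < C * l"
      using C(1) l by simp
    then have G2: "0 < G2 \<alpha> \<beta> N l"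
      using C(2)[OF l] by linarith
    then have pos: "0 < r0" "0 < \<rho>"
      using \<open>1 < l\<^sup>2\<close> by (simp_all add: r0 \<rho>)
    have "r0\<^sup>2 + \<rho>\<^sup>2 = (l * r0)\<^sup>2"
      using \<open>1 < l\<^sup>2\<close> by (simp add: \<rho> power_mult_distrib algebra_simps)
    then have dist: "sqrt (r0\<^sup>2 + \<rho>\<^sup>2) = l * r0"
      using l pos by simp
    have "\<rho> \<le> sqrt (r0\<^sup>2 + \<rho>\<^sup>2)"
      by simp
    then have \<rho>_le: "\<rho> \<le> l * r0"
      by (simp only: dist)
    have "\<rho> = G2 \<alpha> \<beta> N l"
      using \<open>1 < l\<^sup>2\<close> by (simp add: r0 \<rho>)
    then have K\<rho>: "(lj_theta N \<beta> / lj_theta N \<alpha>) powr (1 / (\<beta> - \<alpha>)) \<le> \<rho>"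
        "(\<beta> / \<alpha>) powr (1 / (\<beta> - \<alpha>)) \<le> \<rho>"
      using K by (simp_all add: K_def)
    have "lj_theta N \<beta> / \<rho> powr (\<beta> + 2) \<le> lj_theta N \<alpha> / \<rho> powr (\<alpha> + 2)"
      using assms pos K\<rho> by (intro attraction_dominates lj_theta_pos) auto
    moreover have "\<beta> / \<rho> powr (\<beta> + 2) \<le> \<alpha> / \<rho> powr (\<alpha> + 2)"
      using assms pos K\<rho> by (intro attraction_dominates) auto
    moreover have "\<beta> / (l * r0) powr (\<beta> + 2) \<le> \<alpha> / (l * r0) powr (\<alpha> + 2)"
      using assms pos K\<rho> \<rho>_le l by (intro attraction_dominates) auto
    ultimately have "0 \<le> W"
      by (simp add: W add_divide_distrib)
    moreover have "W = lj_theta N \<alpha> / \<rho> powr (\<alpha> + 2) - lj_theta N \<beta> / \<rho> powr (\<beta> + 2)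
       - lj_coeff \<alpha> \<beta> \<rho> - 2 * lj_coeff \<alpha> \<beta> (sqrt (r0\<^sup>2 + \<rho>\<^sup>2))"
      by (simp add: W dist lj_coeff_def add_divide_distrib)
    moreover have "2 * lj_coeff \<alpha> \<beta> (2 * r0) + lj_coeff \<alpha> \<beta> r0
        + real N * lj_coeff \<alpha> \<beta> (sqrt (r0\<^sup>2 + \<rho>\<^sup>2)) = 0"
      using G2_axis_balance[OF assms(1,2) l, of N, folded r0] by (simp only: dist)
    ultimately show ?thesis
      using lj_solution_rotating_config[OF pos assms(3)] homographic_E_rot by auto
  qed
  show ?thesis
    unfolding Let_def K_def[symmetric]
    by (rule exI[of _ "max 1 (K / C)"]) (use large main in auto)
qed

end
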